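(* For every $n\ge 0$, the number of partitions of $n$ into parts wherein (1) $2$ appears as a part at most $3$ times, (2) the total number of appearances of any two consecutive even numbers is at most $3$, and (3) odd numbers may appear as parts without restriction, equals the number of partitions of $n$ into parts not congruent to $0,\pm 8 \pmod{18}$.
   Context: A partition of $n$ is a finite multiset of positive integers (its parts) with sum $n$. Two consecutive even numbers are $2j$ and $2j+2$ with $j\ge 1$; their total number of appearances is the multiplicity of $2j$ plus the multiplicity of $2j+2$. *)

theory Defs
  imports "HOL-Library.Multiset" "HOL-Number_Theory.Cong"
begin

definition partitions :: "nat \<Rightarrow> nat multiset set" where
  "partitions n = {M. (\<forall>p \<in># M. 0 < p) \<and> sum_mset M = n}"

text \<open>The cardinality of an infinite set is 0 in HOL, so finiteness matters for counting.\<close>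

lemma finite_partitions: "finite (partitions n)"
proof -
  have size_le: "size M \<le> sum_mset M" if "\<forall>p \<in># M. 0 < p" for M :: "nat multiset"
    using that by (induction M) auto
  have "partitions n \<subseteq> mset ` {xs. set xs \<subseteq> {..n} \<and> length xs \<le> n}"
  proof
    fix M assume M: "M \<in> partitions n"
    obtain xs where xs: "mset xs = M" using ex_mset by blast
    have "set xs \<subseteq> {..n}"
      using M xs member_le_sum_list[of _ xs]
      by (auto simp: partitions_def sum_mset_sum_list)
    moreover have "length xs \<le> n"
      using size_le[of M] M xs by (auto simp: partitions_def)
    ultimately show "M \<in> mset ` {xs. set xs \<subseteq> {..n} \<and> length xs \<le> n}"
      using xs by blast
  qed
  then show ?thesis
    by (rule finite_subset) (simp add: finite_lists_length_le)
qed

end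

theory Submission
  imports Defs "HOL-Computational_Algebra.Formal_Power_Series"
begin

text \<open>
  Odd parts are unrestricted on both sides, and halving the even parts turns the two conditions into the
  two sides of Gordon's identity for \<open>k = 4\<close>: partitions in which any two consecutive integers together
  occur at most three times are as numerous as partitions into parts not congruent to \<open>0\<close> or \<open>\<plusminus>4\<close>
  modulo \<open>9\<close>. A partition is the union of its odd parts and its even parts, so a generating function for a
  condition on the halves of the even parts is a product whose first factor counts partitions into odd parts
  and whose second factor depends only on the generating function of the condition
  (\<open>partition_gf_even_halves_cong\<close>). This reduces the theorem to \<open>gordon_identity\<close>.

  Gordon's identity, for arbitrary \<open>0 < i \<le> k\<close> and modulus \<open>2 k + 1\<close>, is proved by Andrews's method. Let
  \<open>G N i\<close> count the partitions into parts above \<open>N\<close> in which \<open>N + 1\<close> occurs fewer than \<open>i\<close> times and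
  consecutive integers together occur fewer than \<open>k\<close> times. Removing the occurrences of the smallest
  part shows \<open>G N (i + 1) = G N i + q^{(N+1)i} G (N + 1) (k - i)\<close>. An explicit alternating series satisfies the
  same recurrence (\<open>sum_andrews_term_Suc\<close>), and the recurrence determines its solution
  (\<open>andrews_recurrence_solution\<close>) because, for \<open>i > 0\<close>, \<open>G N i\<close> tends to \<open>1\<close> as \<open>N\<close> grows. At \<open>N = 0\<close> the
  series is a theta series divided by \<open>(q)_\<infinity>\<close>. The Jacobi triple product factors it into
  the terms \<open>1 - q^p\<close> with \<open>p\<close> congruent to \<open>0\<close> or \<open>\<plusminus>i\<close> modulo \<open>2 k + 1\<close>, which cancel from
  \<open>(q)_\<infinity>\<close> and leave Euler's product for the allowed parts.

  All infinite sums and products are replaced by finite ones modulo \<open>q^M\<close>. The algebra then takes place in an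
  arbitrary commutative ring, without inverses: the triple product comes from a finite identity with
  \<open>q\<close>-binomial coefficients (\<open>finite_jacobi_triple_product\<close>), and inverses of products of
  \<open>1 - X^p\<close> are generating functions of partitions.
\<close>

section \<open>Congruences in commutative rings\<close>
text \<open>Power series identities are proved modulo every power of the variable. The relation
  \<^term>\<open>m dvd a - b\<close>, read as \<open>a \<equiv> b\<close> modulo \<open>m\<close>, expresses this in any commutative ring.\<close>
lemma dvd_diff_trans: "m dvd a - b \<Longrightarrow> m dvd b - c \<Longrightarrow> m dvd a - (c :: 'a :: comm_ring_1)"
  using dvd_add[of m "a - b" "b - c"] by simp

lemma dvd_diff_sym: "m dvd a - b \<Longrightarrow> m dvd b - (a :: 'a :: comm_ring_1)"
  by (metis dvd_minus_iff minus_diff_eq)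

lemma dvd_diff_mult:
  "m dvd a - b \<Longrightarrow> m dvd c - d \<Longrightarrow> m dvd a * c - b * (d :: 'a :: comm_ring_1)"
proof -
  assume "m dvd a - b" "m dvd c - d"
  then have "m dvd (a - b) * c + b * (c - d)" by (intro dvd_add) auto
  then show ?thesis by (simp add: algebra_simps)
qed

lemma dvd_diff_sum:
  "(\<And>x. x \<in> A \<Longrightarrow> m dvd f x - g x) \<Longrightarrow> m dvd sum f A - (sum g A :: 'a :: comm_ring_1)"
  by (simp add: dvd_sum flip: sum_subtractf)

section \<open>Shifted factorials and q-binomial coefficients\<close>
text \<open>In the usual notation this is \<open>(q^{n+1}; q)_m\<close>. Starting at exponent \<open>n + 1\<close> makes it a quotient
  \<open>(q)_{n+m} / (q)_n\<close>, written without a division.\<close>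
definition qpoch :: "'a :: comm_ring_1 \<Rightarrow> nat \<Rightarrow> nat \<Rightarrow> 'a" where
  "qpoch q n m = (\<Prod>j<m. 1 - q ^ (n + j + 1))"

lemma qpoch_0 [simp]: "qpoch q n 0 = 1"
  by (simp add: qpoch_def)

lemma qpoch_Suc: "qpoch q n (Suc m) = qpoch q n m * (1 - q ^ (n + m + 1))"
  by (simp add: qpoch_def)

lemma qpoch_Suc_shift: "qpoch q n (Suc m) = (1 - q ^ (n + 1)) * qpoch q (Suc n) m"
  unfolding qpoch_def by (subst prod.lessThan_Suc_shift) simp

lemma qpoch_add: "qpoch q n (a + b) = qpoch q n a * qpoch q (n + a) b"
  by (induction b) (simp_all add: qpoch_Suc algebra_simps)

lemma qpoch_cong_1: "q ^ (n + 1) dvd qpoch q n m - 1"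
proof (induction m)
  case (Suc m)
  have "q ^ (n + 1) dvd q ^ (n + m + 1)" by (rule le_imp_power_dvd) simp
  then have "q ^ (n + 1) dvd (1 - q ^ (n + m + 1)) - 1" by simp
  from dvd_diff_mult[OF Suc this] show ?case by (simp add: qpoch_Suc)
qed simp

lemma qpoch_cong_qpoch:
  assumes "a \<le> b" "a \<le> c"
  shows "q ^ (a + 1) dvd qpoch q 0 b - qpoch q 0 c"
proof -
  have *: "q ^ (a + 1) dvd qpoch q 0 d - qpoch q 0 a" if "a \<le> d" for d
    using dvd_diff_mult[OF _ qpoch_cong_1[of q a "d - a"], of "qpoch q 0 a" "qpoch q 0 a"]
      qpoch_add[of q 0 a "d - a"] that by simp
  show ?thesis
    using dvd_diff_trans[OF *[OF assms(1)] dvd_diff_sym[OF *[OF assms(2)]]] .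
qed

fun qbinom :: "'a :: comm_ring_1 \<Rightarrow> nat \<Rightarrow> nat \<Rightarrow> 'a" where
  "qbinom q n 0 = 1"
| "qbinom q 0 (Suc k) = 0"
| "qbinom q (Suc n) (Suc k) = qbinom q n k + q ^ Suc k * qbinom q n (Suc k)"

lemma qbinom_eq_0: "n < k \<Longrightarrow> qbinom q n k = 0"
  by (induction q n k rule: qbinom.induct) auto

lemma qbinom_self [simp]: "qbinom q n n = 1"
  by (induction n) (simp_all add: qbinom_eq_0)

text \<open>The second \<open>q\<close>-Pascal rule. Multiplying the triple product by a further factor
  \<open>1 - u Q^m\<close> calls for this one, by a factor \<open>1 - v Q^n\<close> for the one in the definition.\<close>
lemma qbinom_Suc_Suc':
  "k \<le> n \<Longrightarrow> qbinom q (Suc n) (Suc k) = q ^ (n - k) * qbinom q n k + qbinom q n (Suc k)"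
proof (induction q n k rule: qbinom.induct)
  case (1 q n)
  show ?case
  proof (induction n)
    case (Suc n)
    have "qbinom q (Suc (Suc n)) (Suc 0) = 1 + q * qbinom q (Suc n) (Suc 0)"
      by simp
    also have "\<dots> = 1 + q * (q ^ n + qbinom q n (Suc 0))"
      using Suc by simp
    also have "\<dots> = q ^ Suc n + qbinom q (Suc n) (Suc 0)"
      by (simp add: algebra_simps)
    finally show ?case by simp
  qed simp
next
  case (3 q n k)
  show ?case
  proof (cases "n = k")
    case True
    then show ?thesis by (simp add: qbinom_eq_0)
  next
    case False
    with 3 have kn: "Suc k \<le> n" by simp
    then have d: "n - k = Suc (n - Suc k)" by simp
    have "qbinom q (Suc (Suc n)) (Suc (Suc k))
        = qbinom q (Suc n) (Suc k) + q ^ Suc (Suc k) * qbinom q (Suc n) (Suc (Suc k))"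
      by simp
    also have "\<dots> = (q ^ (n - k) * qbinom q n k + qbinom q n (Suc k))
        + q ^ Suc (Suc k) * (q ^ (n - Suc k) * qbinom q n (Suc k) + qbinom q n (Suc (Suc k)))"
      using 3 kn by simp
    also have "\<dots> = q ^ (n - k) * (qbinom q n k + q ^ Suc k * qbinom q n (Suc k))
        + (qbinom q n (Suc k) + q ^ Suc (Suc k) * qbinom q n (Suc (Suc k)))"
      unfolding d by (simp add: algebra_simps)
    finally show ?thesis by simp
  qed
qed simp

text \<open>The product formula for the \<open>q\<close>-binomial coefficient, with the denominator \<open>(q)_k\<close> cleared so
  that it holds in every commutative ring. Since the right-hand side is \<open>1\<close> modulo \<open>q^{n+1}\<close>, it also gives
  the limit of the coefficient.\<close>
lemma qbinom_mult_qpoch: "qbinom q (n + k) k * qpoch q 0 k = qpoch q n k"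
proof (induction "n + k" arbitrary: n k)
  case 0
  then show ?case by simp
next
  case (Suc m)
  show ?case
  proof (cases k)
    case k: (Suc l)
    show ?thesis
    proof (cases n)
      case 0
      then show ?thesis by simp
    next
      case n: (Suc p)
      have 1: "qbinom q (n + l) l * qpoch q 0 l = qpoch q n l"
        using Suc k by (intro Suc) auto
      have 2: "qbinom q (p + k) k * qpoch q 0 k = qpoch q p k"
        using Suc n by (intro Suc) auto
      have e: "p + k = n + l" using k n by simp
      have "qbinom q (n + k) k * qpoch q 0 k
          = (qbinom q (n + l) l * qpoch q 0 l) * (1 - q ^ k) + q ^ k * (qbinom q (p + k) k * qpoch q 0 k)"
        unfolding e using k by (simp add: qpoch_Suc algebra_simps)
      also have "\<dots> = qpoch q n l * (1 - q ^ k) + q ^ k * qpoch q p k"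
        by (simp only: 1 2)
      also have "qpoch q p k = (1 - q ^ n) * qpoch q n l"
        using k n by (simp add: qpoch_Suc_shift)
      also have "qpoch q n l * (1 - q ^ k) + q ^ k * ((1 - q ^ n) * qpoch q n l) = qpoch q n k"
        using k by (simp add: qpoch_Suc algebra_simps power_add)
      finally show ?thesis .
    qed
  qed simp
qed

section \<open>The Jacobi triple product\<close>
text \<open>For every integer \<open>j\<close>, negative ones included, both exponents are natural numbers. So the bilateral
  theta series \<open>\<Sum>j. (-1)^j u^{j(j+1)/2} v^{j(j-1)/2}\<close> with \<open>Q = u v\<close> makes sense in a commutative ring, where the
  customary form \<open>\<Sum>j. (-1)^j z^j Q^{j(j-1)/2}\<close> would need an inverse of \<open>z\<close>.\<close>
definition theta_term :: "'a :: comm_ring_1 \<Rightarrow> 'a \<Rightarrow> int \<Rightarrow> 'a" where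
  "theta_term u v j = u ^ nat (j * (j + 1) div 2) * v ^ nat (j * (j - 1) div 2)"

lemma theta_term_minus: "theta_term u v (- j) = theta_term v u j"
  by (simp add: theta_term_def algebra_simps)

lemma theta_term_Suc:
  "theta_term u v (int n + 1) = u * (u * v) ^ n * theta_term u v (int n)"
proof -
  have "nat ((int n + 1) * (int n + 1 + 1) div 2) = Suc n + nat (int n * (int n + 1) div 2)"
  proof -
    have "(int n + 1) * (int n + 1 + 1) = int n * (int n + 1) + (int n + 1) * 2"
      by (simp add: algebra_simps)
    then have "(int n + 1) * (int n + 1 + 1) div 2 = int n * (int n + 1) div 2 + (int n + 1)"
      by simp
    then show ?thesis by (simp add: nat_add_distrib)
  qed
  moreover have "nat ((int n + 1) * (int n + 1 - 1) div 2) = n + nat (int n * (int n - 1) div 2)"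
  proof -
    have "(int n + 1) * (int n + 1 - 1) = int n * (int n - 1) + int n * 2"
      by (simp add: algebra_simps)
    then have "(int n + 1) * (int n + 1 - 1) div 2 = int n * (int n - 1) div 2 + int n"
      by simp
    moreover have "int n * (int n - 1) div 2 \<ge> 0" by (cases n) auto
    ultimately show ?thesis by (simp add: nat_add_distrib)
  qed
  ultimately show ?thesis
    by (simp add: theta_term_def power_add power_mult_distrib algebra_simps)
qed

lemma theta_term_step_up:
  assumes "j \<le> int m"
  shows "u * (u * v) ^ m * theta_term u v j = (u * v) ^ nat (int m - j) * theta_term u v (j + 1)"
proof (cases "0 \<le> j")
  case True
  then obtain n where n: "j = int n" using nonneg_int_cases by blast
  with assms have "n \<le> m" by simp
  then have "m = (m - n) + n" by simp
  then have "(u * v) ^ m = (u * v) ^ (m - n) * (u * v) ^ n" by (metis power_add)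
  moreover have "nat (int m - j) = m - n" using n by simp
  ultimately show ?thesis unfolding n by (simp only: theta_term_Suc mult_ac)
next
  case False
  define n where "n = nat (- j - 1)"
  have j: "j = - (int n + 1)" using False by (simp add: n_def)
  have "theta_term u v j = v * (v * u) ^ n * theta_term u v (j + 1)"
    using theta_term_Suc[of v u n] theta_term_minus[of u v "int n + 1"] theta_term_minus[of u v "int n"]
    by (simp add: j)
  moreover have "nat (int m - j) = m + n + 1" by (simp add: j)
  ultimately show ?thesis by (simp add: power_add algebra_simps)
qed

lemma theta_term_step_down:
  assumes "- int m \<le> j"
  shows "v * (u * v) ^ m * theta_term u v j = (u * v) ^ nat (int m + j) * theta_term u v (j - 1)"
  using theta_term_step_up[of "- j" m v u] assms theta_term_minus[of u v "-j"] theta_term_minus[of u v "1-j"]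
  by (simp add: algebra_simps)

lemma theta_term_0 [simp]: "theta_term u v 0 = 1" by (simp add: theta_term_def)

text \<open>Each factor is added by one of the two \<open>q\<close>-Pascal rules, because \<open>theta_term_step_up\<close> and
  \<open>theta_term_step_down\<close> turn the multiplication by \<open>u Q^m\<close> or \<open>v Q^n\<close> into a shift of the summation
  index. The index \<open>l\<close> stands for \<open>j + n\<close>, so that the range \<open>-n \<le> j \<le> m\<close> starts at \<open>0\<close>.\<close>
theorem finite_jacobi_triple_product:
  fixes u v :: "'a :: comm_ring_1"
  shows "(\<Prod>j<m. 1 - u * (u * v) ^ j) * (\<Prod>j<n. 1 - v * (u * v) ^ j)
    = (\<Sum>l\<le>m + n. (- 1) ^ (l + n) * qbinom (u * v) (m + n) l * theta_term u v (int l - int n))"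
    (is "?P m n = ?S m n")
proof (induction m)
  case 0
  show ?case
  proof (induction n)
    case (Suc n)
    have 1: "v * (u * v) ^ n * theta_term u v (int l - int n)
        = (u * v) ^ l * theta_term u v (int l - int (Suc n))" for l
      using theta_term_step_down[of n "int l - int n" v u] by (simp add: algebra_simps)
    have "?P 0 (Suc n) = ?S 0 n * (1 - v * (u * v) ^ n)"
      using Suc by simp
    also have "\<dots> = ?S 0 n
       + (\<Sum>l\<le>n. (- 1) ^ (l + Suc n) * qbinom (u * v) n l * (v * (u * v) ^ n * theta_term u v (int l - int n)))"
      by (simp add: algebra_simps sum_distrib_left sum_negf sum_subtractf)
    also have "(\<Sum>l\<le>n. (- 1) ^ (l + Suc n) * qbinom (u * v) n l * (v * (u * v) ^ n * theta_term u v (int l - int n)))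
      = (\<Sum>l\<le>Suc n. (- 1) ^ (l + Suc n) * qbinom (u * v) n l * (u * v) ^ l * theta_term u v (int l - int (Suc n)))"
      unfolding 1 by (simp add: qbinom_eq_0 mult.assoc)
    also have "\<dots> = (- 1) ^ Suc n * theta_term u v (- int (Suc n)) +
      (\<Sum>l\<le>n. (- 1) ^ (l + n) * qbinom (u * v) n (Suc l) * (u * v) ^ Suc l * theta_term u v (int l - int n))"
      by (subst sum.atMost_Suc_shift) simp
    also have "?S 0 n + \<dots> = ?S 0 (Suc n)"
      by (simp add: sum.atMost_Suc_shift algebra_simps sum.distrib del: sum.atMost_Suc)
    finally show ?case .
  qed simp
next
  case (Suc m)
  have 1: "u * (u * v) ^ m * theta_term u v (int l - int n)
      = (u * v) ^ (m + n - l) * theta_term u v (int (Suc l) - int n)" if "l \<le> m + n" for l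
  proof -
    have "nat (int m - (int l - int n)) = m + n - l" using that by simp
    then show ?thesis
      using theta_term_step_up[of "int l - int n" m u v] that by (simp add: algebra_simps)
  qed
  have "?P (Suc m) n = ?S m n * (1 - u * (u * v) ^ m)"
    using Suc by (simp add: algebra_simps)
  also have "\<dots> = ?S m n
     + (\<Sum>l\<le>m+n. (- 1) ^ (Suc l + n) * qbinom (u * v) (m+n) l * (u * (u * v) ^ m * theta_term u v (int l - int n)))"
    by (simp add: algebra_simps sum_distrib_left sum_negf sum_subtractf)
  also have "(\<Sum>l\<le>m+n. (- 1) ^ (Suc l + n) * qbinom (u * v) (m+n) l * (u * (u * v) ^ m * theta_term u v (int l - int n)))
    = (\<Sum>l\<le>m+n. (- 1) ^ (Suc l + n) * ((u * v) ^ (m + n - l) * qbinom (u * v) (m+n) l) * theta_term u v (int (Suc l) - int n))"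
    by (rule sum.cong) (use 1 in \<open>simp_all add: algebra_simps\<close>)
  also have "?S m n = (\<Sum>l\<le>Suc (m+n). (- 1) ^ (l + n) * qbinom (u * v) (m + n) l * theta_term u v (int l - int n))"
    by (simp add: qbinom_eq_0)
  also have "\<dots> = (-1) ^ n * theta_term u v (- int n) +
     (\<Sum>l\<le>m+n. (- 1) ^ (Suc l + n) * qbinom (u * v) (m + n) (Suc l) * theta_term u v (int (Suc l) - int n))"
    by (subst sum.atMost_Suc_shift) simp
  also have "\<dots> + (\<Sum>l\<le>m+n. (- 1) ^ (Suc l + n) * ((u * v) ^ (m + n - l) * qbinom (u * v) (m+n) l) * theta_term u v (int (Suc l) - int n))
    = (-1) ^ n * theta_term u v (- int n) +
     (\<Sum>l\<le>m+n. (- 1) ^ (Suc l + n) * qbinom (u * v) (Suc (m + n)) (Suc l) * theta_term u v (int (Suc l) - int n))"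
    unfolding add.assoc sum.distrib[symmetric]
    by (intro arg_cong2[of _ _ _ _ "(+)"] sum.cong refl, subst qbinom_Suc_Suc')
       (simp_all add: algebra_simps del: qbinom.simps)
  also have "\<dots> = ?S (Suc m) n"
    by (simp add: sum.atMost_Suc_shift del: sum.atMost_Suc qbinom.simps(3))
  finally show ?case .
qed

lemma power_dvd_theta_term:
  assumes "q dvd u" "q dvd v"
  shows "q ^ nat \<bar>j\<bar> dvd theta_term u v j"
proof -
  have *: "q ^ n dvd theta_term a b (int n)" if "q dvd a" for a b :: 'a and n
  proof (induction n)
    case (Suc n)
    have "q * q ^ n dvd a * theta_term a b (int n)" using that Suc by (rule mult_dvd_mono)
    then have "q * q ^ n dvd (a * b) ^ n * (a * theta_term a b (int n))" by (rule dvd_mult)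
    moreover have "theta_term a b (int (Suc n)) = (a * b) ^ n * (a * theta_term a b (int n))"
      using theta_term_Suc[of a b n] by (simp add: add.commute mult_ac)
    ultimately show ?case by simp
  qed simp
  show ?thesis
    using *[OF assms(1), of "nat j" v] *[OF assms(2), of "nat (- j)" u] theta_term_minus[of u v "- j"]
    by (cases "0 \<le> j") auto
qed

text \<open>Both sides of the product formula are truncated: \<open>(q)_n\<close> agrees with \<open>(q)_k\<close> up to the smaller
  of \<open>n\<close> and \<open>k\<close>, and \<open>(q^{2n-k+1}; q)_k\<close> agrees with \<open>1\<close> up to \<open>2n - k\<close>.\<close>
lemma qpoch_mult_central_qbinom:
  assumes "k \<le> 2 * n"
  shows "q ^ min k (2 * n - k) dvd qpoch q 0 n * qbinom q (2 * n) k - 1"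
proof -
  let ?m = "min k (2 * n - k)"
  have "q ^ (?m + 1) dvd qpoch q 0 n - qpoch q 0 k"
    by (rule qpoch_cong_qpoch) (use assms in auto)
  then have "q ^ ?m dvd qpoch q 0 n - qpoch q 0 k"
    by (rule dvd_trans[rotated]) (simp add: le_imp_power_dvd)
  from dvd_diff_mult[OF this, of "qbinom q (2 * n) k" "qbinom q (2 * n) k"]
  have "q ^ ?m dvd qpoch q 0 n * qbinom q (2 * n) k - qpoch q (2 * n - k) k"
    using qbinom_mult_qpoch[of q "2 * n - k" k] assms by (simp add: mult.commute)
  moreover have "q ^ ?m dvd qpoch q (2 * n - k) k - 1"
    by (rule dvd_trans[OF _ qpoch_cong_1]) (simp add: le_imp_power_dvd)
  ultimately show ?thesis by (rule dvd_diff_trans)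
qed

text \<open>Letting \<open>n\<close> grow in the finite identity. The coefficient of the term with index \<open>j\<close> is correct only
  modulo \<open>q^{n-|j|}\<close>, but that term is itself divisible by \<open>q^{|j|}\<close>, so the error is uniformly
  divisible by \<open>q^n\<close>. Indices \<open>l\<close> and \<open>-(l+1)\<close> are paired because this is how the series arises from
  the recurrence below.\<close>
theorem truncated_jacobi_triple_product:
  fixes u v :: "'a :: comm_ring_1"
  assumes "q dvd u" "q dvd v"
  shows "q ^ n dvd qpoch (u * v) 0 n * ((\<Prod>j<n. 1 - u * (u * v) ^ j) * (\<Prod>j<n. 1 - v * (u * v) ^ j))
    - (\<Sum>l<n. (- 1) ^ l * (theta_term u v (int l) - theta_term u v (- int (Suc l))))"
proof -
  define g where "g l = (- 1) ^ (l + n) * theta_term u v (int l - int n)" for l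
  have trunc: "q ^ n dvd qpoch (u * v) 0 n * (\<Sum>l\<le>n + n. (- 1) ^ (l + n) * qbinom (u * v) (n + n) l * theta_term u v (int l - int n))
       - (\<Sum>l\<le>n + n. g l)"
    unfolding sum_distrib_left
  proof (rule dvd_diff_sum)
    fix l assume l: "l \<in> {..n + n}"
    let ?m = "min l (2 * n - l)"
    \<comment> \<open>the precision lost in the coefficient is what the theta term supplies\<close>
    have "q ^ ?m dvd (u * v) ^ ?m" using assms by (simp add: dvd_power_same)
    also have "\<dots> dvd qpoch (u * v) 0 n * qbinom (u * v) (2 * n) l - 1"
      using l by (intro qpoch_mult_central_qbinom) auto
    finally have "q ^ ?m * q ^ nat \<bar>int l - int n\<bar> dvd
        (qpoch (u * v) 0 n * qbinom (u * v) (2 * n) l - 1) * theta_term u v (int l - int n)"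
      using power_dvd_theta_term[OF assms] by (rule mult_dvd_mono)
    moreover have "?m + nat \<bar>int l - int n\<bar> = n" using l by auto
    ultimately have "q ^ n dvd
        (qpoch (u * v) 0 n * qbinom (u * v) (2 * n) l - 1) * theta_term u v (int l - int n)"
      by (simp flip: power_add)
    then have "q ^ n dvd (- 1) ^ (l + n) *
        ((qpoch (u * v) 0 n * qbinom (u * v) (2 * n) l - 1) * theta_term u v (int l - int n))"
      by (rule dvd_mult)
    then show "q ^ n dvd qpoch (u * v) 0 n * ((- 1) ^ (l + n) * qbinom (u * v) (n + n) l * theta_term u v (int l - int n)) - g l"
      unfolding mult_2[symmetric] g_def by (simp add: algebra_simps)
  qed
  have "(\<Sum>l\<le>n + n. g l) = (\<Sum>l<n. (- 1) ^ l * (theta_term u v (int l) - theta_term u v (- int (Suc l)))) + g (n + n)"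
  proof -
    have split: "(\<Sum>l<n + m. g l) = (\<Sum>l<n. g l) + (\<Sum>l<m. g (n + l))" for m
      by (induction m) (simp_all add: algebra_simps)
    have "(\<Sum>l<n. g l) = (\<Sum>l<n. g (n - Suc l))"
      by (rule sum.nat_diff_reindex[symmetric])
    also have "\<dots> = (\<Sum>l<n. (- 1) ^ Suc l * theta_term u v (- int (Suc l)))"
    proof (rule sum.cong)
      fix l assume "l \<in> {..<n}"
      then obtain r where "n = Suc l + r" by (metis lessThan_iff less_iff_Suc_add add_Suc)
      moreover from this have "n - Suc l + n = 2 * r + Suc l" by simp
      then have "(- 1 :: 'a) ^ (n - Suc l + n) = (- 1) ^ Suc l" by (simp only: power_add power_mult) simp
      ultimately show "g (n - Suc l) = (- 1) ^ Suc l * theta_term u v (- int (Suc l))"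
        by (simp add: g_def)
    qed simp
    finally have neg: "(\<Sum>l<n. g l) = (\<Sum>l<n. (- 1) ^ Suc l * theta_term u v (- int (Suc l)))" .
    have sign: "(- 1 :: 'a) ^ (n + l + n) = (- 1) ^ l" for l
    proof -
      have "n + l + n = 2 * n + l" by simp
      then show ?thesis by (simp only: power_add power_mult) simp
    qed
    have "(\<Sum>l<n. g (n + l)) = (\<Sum>l<n. (- 1) ^ l * theta_term u v (int l))"
      by (simp add: g_def sign)
    then have "(\<Sum>l<n + n. g l) = (\<Sum>l<n. (- 1) ^ l * (theta_term u v (int l) - theta_term u v (- int (Suc l))))"
      unfolding split neg by (simp add: algebra_simps sum_subtractf sum_negf)
    then show ?thesis by (simp flip: lessThan_Suc_atMost)
  qed
  moreover have "q ^ n dvd g (n + n)"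
    using power_dvd_theta_term[OF assms, of "int n"] by (simp add: g_def)
  ultimately have "q ^ n dvd (\<Sum>l\<le>n + n. g l)
      - (\<Sum>l<n. (- 1) ^ l * (theta_term u v (int l) - theta_term u v (- int (Suc l))))"
    by simp
  with trunc show ?thesis
    unfolding finite_jacobi_triple_product by (rule dvd_diff_trans)
qed

section \<open>Andrews's recurrence and the theta series\<close>
definition triangular :: "nat \<Rightarrow> nat" where "triangular n = \<Sum>{..n}"

lemma triangular_0 [simp]: "triangular 0 = 0" and triangular_Suc [simp]: "triangular (Suc n) = triangular n + Suc n"
  by (simp_all add: triangular_def)

lemma triangular_ge: "n \<le> triangular n"
  by (induction n) auto

text \<open>The theta series of modulus \<open>d\<close>: the exponents are \<open>d j(j+1)/2 - i j\<close> for \<open>j = n\<close> and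
  \<open>j = -(n+1)\<close>.\<close>
lemma theta_term_power:
  assumes "i \<le> d"
  shows "theta_term (q ^ (d - i)) (q ^ i) (int n) = q ^ (d * triangular n - i * n)"
    and "theta_term (q ^ (d - i)) (q ^ i) (- int (Suc n)) = q ^ (d * triangular n + Suc n * i)"
proof -
  have *: "theta_term (q ^ (d - i)) (q ^ i) (int n) = q ^ (d * triangular n - i * n)" if "i \<le> d" for i n
  proof (induction n)
    case (Suc n)
    have Q: "q ^ (d - i) * q ^ i = q ^ d" using that by (simp flip: power_add)
    have "i * n \<le> d * triangular n" using that triangular_ge mult_le_mono by blast
    then have "(d - i) + (d * n + (d * triangular n - i * n)) = d * triangular (Suc n) - i * Suc n"
      using that by (simp add: algebra_simps)
    moreover have "theta_term (q ^ (d - i)) (q ^ i) (int (Suc n))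
        = q ^ (d - i) * (q ^ d) ^ n * q ^ (d * triangular n - i * n)"
      using theta_term_Suc[of "q ^ (d - i)" "q ^ i" n] unfolding Q Suc by (simp add: add.commute)
    ultimately show ?case
      by (simp only: mult.assoc add.assoc flip: power_add power_mult)
  qed simp
  show "theta_term (q ^ (d - i)) (q ^ i) (int n) = q ^ (d * triangular n - i * n)"
    using assms by (rule *)
  have Q: "q ^ i * q ^ (d - i) = q ^ d" using assms by (simp flip: power_add)
  have "theta_term (q ^ (d - i)) (q ^ i) (- int (Suc n)) = theta_term (q ^ i) (q ^ (d - i)) (int n + 1)"
    using theta_term_minus[of "q ^ (d - i)" "q ^ i" "int n + 1"] by (simp add: algebra_simps)
  also have "\<dots> = q ^ (i + d * n + (d * triangular n - (d - i) * n))"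
    using *[of "d - i" n] assms by (simp add: theta_term_Suc Q power_add flip: power_mult)
  also have "i + d * n + (d * triangular n - (d - i) * n) = d * triangular n + Suc n * i"
  proof -
    obtain t where t: "triangular n = n + t" using triangular_ge le_Suc_ex by blast
    obtain e where e: "d = i + e" using assms le_Suc_ex by blast
    show ?thesis unfolding t e by (simp add: algebra_simps)
  qed
  finally show "theta_term (q ^ (d - i)) (q ^ i) (- int (Suc n)) = q ^ (d * triangular n + Suc n * i)" .
qed

text \<open>Andrews's function is \<open>J_{k,i}(x) = \<Sum>n. (-1)^n x^{kn} q^{(2k+1)n(n+1)/2 - in} (1 - x^i q^{(2n+1)i}) /
  ((q)_n (x q^{n+1})_\<infinity>)\<close>. At \<open>x = q^N\<close> and after multiplication by \<open>(q)_\<infinity>\<close> the denominators become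
  the polynomial \<open>(q^{n+1}; q)_N\<close>, and the \<open>n\<close>-th summand is the one below. The subtraction of natural
  numbers in the exponent is exact for \<open>i \<le> 2 k + 1\<close>.\<close>
definition andrews_term :: "'a :: comm_ring_1 \<Rightarrow> nat \<Rightarrow> nat \<Rightarrow> nat \<Rightarrow> nat \<Rightarrow> 'a" where
  "andrews_term q k N i n = (- 1) ^ n * q ^ (k * N * n) * qpoch q n N *
     (q ^ ((2 * k + 1) * triangular n - i * n) - q ^ ((2 * k + 1) * triangular n + (N + n + 1) * i))"

lemma andrews_term_0: "andrews_term q k N 0 n = 0"
  by (simp add: andrews_term_def)

text \<open>The functional equation \<open>J_{k,i+1}(x) - J_{k,i}(x) = (x q)^i J_{k,k-i}(x q)\<close> at \<open>x = q^N\<close>. The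
  difference of the two \<open>n\<close>-th summands splits into a part \<open>A n\<close> with a factor \<open>1 - q^n\<close>
  and a part \<open>B n\<close> with a factor \<open>1 - q^{N+n+1}\<close>; both factors extend the product \<open>(q^{n+1}; q)_N\<close>, on the
  left and on the right. Then \<open>B n + A (n + 1)\<close> is the \<open>n\<close>-th summand of the right-hand side. The sum of the
  \<open>A n\<close> is shifted by one place, which costs only \<open>A M\<close>, a multiple of \<open>q^M\<close>.\<close>
lemma sum_andrews_term_Suc:
  assumes "i < k"
  shows "q ^ M dvd (\<Sum>n<M. andrews_term q k N (Suc i) n)
    - ((\<Sum>n<M. andrews_term q k N i n) + q ^ ((N + 1) * i) * (\<Sum>n<M. andrews_term q k (N + 1) (k - i) n))"
proof -
  define d where "d = 2 * k + 1"
  define A where "A n = (- 1) ^ n * q ^ (k * N * n) * qpoch q n N * (1 - q ^ n) * q ^ (d * triangular n - Suc i * n)" for n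
  define B where "B n = (- 1) ^ n * q ^ (k * N * n) * qpoch q n (Suc N) * q ^ (d * triangular n + (N + n + 1) * i)" for n
  obtain e where e: "k = Suc (i + e)" using assms less_iff_Suc_add by auto
  have le: "Suc i * n \<le> d * triangular n" for n
    using triangular_ge[of n] assms by (intro mult_le_mono) (auto simp: d_def)
  have 1: "andrews_term q k N (Suc i) n - andrews_term q k N i n = A n + B n" for n
  proof -
    have "q ^ (d * triangular n - i * n) = q ^ n * q ^ (d * triangular n - Suc i * n)"
      using le[of n] by (simp flip: power_add)
    moreover have "q ^ (d * triangular n + (N + n + 1) * Suc i) = q ^ (n + N + 1) * q ^ (d * triangular n + (N + n + 1) * i)"
      by (simp add: algebra_simps flip: power_add)
    ultimately show ?thesis
      unfolding andrews_term_def A_def B_def qpoch_Suc d_def[symmetric] by (simp add: ring_distribs mult_ac)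
  qed
  have 2: "B n + A (Suc n) = q ^ ((N + 1) * i) * andrews_term q k (N + 1) (k - i) n" for n
  proof -
    obtain t where t: "triangular n = n + t" using triangular_ge le_Suc_ex by blast
    have x: "k * N * n + (d * triangular n + (N + n + 1) * i)
        = (N + 1) * i + k * (N + 1) * n + (d * triangular n - (k - i) * n)"
      unfolding t d_def e by (simp add: algebra_simps)
    have y: "k * N * Suc n + (d * triangular (Suc n) - Suc i * Suc n)
        = (N + 1) * i + k * (N + 1) * n + (d * triangular n + (N + 1 + n + 1) * (k - i))"
      unfolding triangular_Suc t d_def e by (simp add: algebra_simps)
    have "A (Suc n) = - ((- 1) ^ n * q ^ (k * N * Suc n) * ((1 - q ^ Suc n) * qpoch q (Suc n) N) * q ^ (d * triangular (Suc n) - Suc i * Suc n))"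
      unfolding A_def by (simp add: mult_ac)
    also have "(1 - q ^ Suc n) * qpoch q (Suc n) N = qpoch q n (Suc N)"
      by (simp add: qpoch_Suc_shift)
    finally have "B n + A (Suc n) = (- 1) ^ n * qpoch q n (Suc N) *
        (q ^ (k * N * n + (d * triangular n + (N + n + 1) * i)) - q ^ (k * N * Suc n + (d * triangular (Suc n) - Suc i * Suc n)))"
      unfolding B_def power_add by (simp add: ring_distribs mult_ac)
    also have "\<dots> = q ^ ((N + 1) * i) * andrews_term q k (N + 1) (k - i) n"
      unfolding x y andrews_term_def d_def[symmetric] power_add[of q "(N + 1) * i + k * (N + 1) * n"]
      by (simp add: ring_distribs mult_ac power_add)
    finally show ?thesis .
  qed
  have "(\<Sum>n<M. andrews_term q k N (Suc i) n) - (\<Sum>n<M. andrews_term q k N i n) = (\<Sum>n<M. A n) + (\<Sum>n<M. B n)"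
    by (simp add: 1 sum.distrib flip: sum_subtractf)
  also have "(\<Sum>n<M. A n) = (\<Sum>n<M. A (Suc n)) - A M"
  proof -
    have "A 0 = 0" by (simp add: A_def)
    then show ?thesis using sum.lessThan_Suc_shift[of A M] by (simp add: algebra_simps)
  qed
  moreover have "q ^ ((N + 1) * i) * (\<Sum>n<M. andrews_term q k (N + 1) (k - i) n) = (\<Sum>n<M. B n) + (\<Sum>n<M. A (Suc n))"
    by (simp only: sum_distrib_left sum.distrib flip: 2)
  ultimately have "(\<Sum>n<M. andrews_term q k N (Suc i) n)
    - ((\<Sum>n<M. andrews_term q k N i n) + q ^ ((N + 1) * i) * (\<Sum>n<M. andrews_term q k (N + 1) (k - i) n)) = - A M"
    by (simp add: algebra_simps)
  moreover have "q ^ M dvd A M"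
  proof -
    have "Suc i * M + M \<le> d * triangular M"
      using triangular_ge[of M] assms mult_le_mono[of "Suc (Suc i)" d M "triangular M"] by (simp add: d_def)
    then have "q ^ M dvd q ^ (d * triangular M - Suc i * M)" by (intro le_imp_power_dvd) simp
    then show ?thesis by (simp add: A_def)
  qed
  ultimately show ?thesis by simp
qed

text \<open>The recurrence expresses level \<open>N\<close> through level \<open>N + 1\<close>, so a solution modulo \<open>q^M\<close> is determined
  by its values at level \<open>M\<close>. There the series reduces to its first summand, which for \<open>i > 0\<close> is \<open>(q)_M\<close> modulo
  \<open>q^M\<close>.\<close>
theorem andrews_recurrence_solution:
  fixes G :: "nat \<Rightarrow> nat \<Rightarrow> 'a :: comm_ring_1"
  assumes G0: "\<And>N. G N 0 = 0"
    and GS: "\<And>N i. i < k \<Longrightarrow> G N (Suc i) = G N i + q ^ ((N + 1) * i) * G (N + 1) (k - i)"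
    and lim: "\<And>i. 0 < i \<Longrightarrow> i \<le> k \<Longrightarrow> q ^ M dvd G M i - 1"
    and "N \<le> M" "i \<le> k"
  shows "q ^ M dvd (\<Sum>n<M. andrews_term q k N i n) - qpoch q 0 M * G N i"
  using \<open>N \<le> M\<close> \<open>i \<le> k\<close>
proof (induction N arbitrary: i rule: inc_induct)
  case base
  show ?case
  proof (cases "i = 0 \<or> M = 0")
    case True
    then show ?thesis by (auto simp: G0 andrews_term_0)
  next
    case False
    then obtain m where m: "M = Suc m" by (cases M) auto
    have k: "k \<ge> 1" using False base by simp
    have "q ^ M dvd andrews_term q k M i (Suc n)" for n
    proof -
      have "M \<le> k * M * Suc n" using mult_le_mono[of 1 "k * Suc n" M M] k by (simp add: mult_ac)
      then have "q ^ M dvd q ^ (k * M * Suc n)" by (rule le_imp_power_dvd)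
      then show ?thesis unfolding andrews_term_def by (intro dvd_mult2 dvd_mult)
    qed
    then have "q ^ M dvd (\<Sum>n<m. andrews_term q k M i (Suc n))" by (rule dvd_sum)
    then have 1: "q ^ M dvd (\<Sum>n<M. andrews_term q k M i n) - andrews_term q k M i 0"
      unfolding m sum.lessThan_Suc_shift by simp
    have "M \<le> (M + 1) * i" using False by (cases i) auto
    then have "q ^ M dvd q ^ ((M + 1) * i)" by (rule le_imp_power_dvd)
    then have 2: "q ^ M dvd andrews_term q k M i 0 - qpoch q 0 M"
      by (simp add: andrews_term_def algebra_simps)
    have 3: "q ^ M dvd qpoch q 0 M - qpoch q 0 M * G M i"
      using dvd_diff_mult[OF _ dvd_diff_sym[OF lim[of i]], of "qpoch q 0 M" "qpoch q 0 M"] False base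
      by simp
    show ?thesis using 1 2 3 dvd_diff_trans by blast
  qed
next
  case (step N)
  show ?case using \<open>i \<le> k\<close>
  proof (induction i)
    case 0
    then show ?case by (simp add: G0 andrews_term_0)
  next
    case (Suc i)
    then have i: "i < k" and IH: "q ^ M dvd (\<Sum>n<M. andrews_term q k N i n) - qpoch q 0 M * G N i" by auto
    have "q ^ M dvd q ^ ((N + 1) * i) * (\<Sum>n<M. andrews_term q k (N + 1) (k - i) n)
        - q ^ ((N + 1) * i) * (qpoch q 0 M * G (N + 1) (k - i))"
      using step.IH[of "k - i"] by (intro dvd_diff_mult) auto
    from dvd_add[OF IH this]
    have "q ^ M dvd ((\<Sum>n<M. andrews_term q k N i n) + q ^ ((N + 1) * i) * (\<Sum>n<M. andrews_term q k (N + 1) (k - i) n))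
       - qpoch q 0 M * G N (Suc i)"
      using GS[OF i, of N] by (simp add: algebra_simps)
    with sum_andrews_term_Suc[OF i] show ?case by (rule dvd_diff_trans)
  qed
qed

text \<open>The inequality \<open>2 i < d\<close> makes the three residue classes \<open>0\<close>, \<open>i\<close> and \<open>d - i\<close> distinct, so that each
  factor \<open>1 - q^p\<close> occurs once.\<close>
lemma triple_product_residue_classes:
  fixes q :: "'a :: comm_ring_1"
  assumes "0 < i" "2 * i < d"
  shows "qpoch (q ^ d) 0 n * ((\<Prod>j<n. 1 - q ^ (d - i) * (q ^ d) ^ j) * (\<Prod>j<n. 1 - q ^ i * (q ^ d) ^ j))
    = (\<Prod>p \<in> {1..d * n} \<inter> {p. p mod d \<in> {0, i, d - i}}. 1 - q ^ p)"
proof (induction n)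
  case (Suc n)
  let ?R = "{p. p mod d \<in> {0, i, d - i}}"
  let ?B = "{d * n + d, d * n + i, d * n + (d - i)}"
  have "{1..d * Suc n} \<inter> ?R = ({1..d * n} \<inter> ?R) \<union> ?B"
  proof (rule set_eqI)
    fix p
    show "p \<in> {1..d * Suc n} \<inter> ?R \<longleftrightarrow> p \<in> ({1..d * n} \<inter> ?R) \<union> ?B"
    proof (cases "p \<le> d * n")
      case True
      then show ?thesis using assms by auto
    next
      case False
      then obtain r where p: "p = d * n + r" "r > 0" by (metis less_imp_add_positive not_le)
      have "r \<le> d \<and> r mod d \<in> {0, i, d - i} \<longleftrightarrow> r \<in> {d, i, d - i}"
        using assms p(2) by (cases "r < d") (auto simp: not_less)
      then show ?thesis using p by auto
    qed
  qed
  moreover have "({1..d * n} \<inter> ?R) \<inter> ?B = {}" using assms by auto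
  ultimately have "(\<Prod>p \<in> {1..d * Suc n} \<inter> ?R. 1 - q ^ p)
      = (\<Prod>p \<in> {1..d * n} \<inter> ?R. 1 - q ^ p) * (\<Prod>p \<in> ?B. 1 - q ^ p)"
    using prod.union_disjoint[of "{1..d * n} \<inter> ?R" ?B "\<lambda>p. 1 - q ^ p"] by simp
  also have "(\<Prod>p \<in> ?B. 1 - q ^ p) = (1 - q ^ (d * n + d)) * ((1 - q ^ (d * n + (d - i))) * (1 - q ^ (d * n + i)))"
    using assms by (subst prod.insert | simp)+
  finally show ?case
    unfolding Suc[symmetric]
    by (simp add: qpoch_Suc power_add mult_ac flip: power_mult)
qed simp

section \<open>Generating functions of partitions\<close>
lemma fps_X_power_dvd_iff: "fps_X ^ m dvd (f :: 'a :: comm_ring_1 fps) \<longleftrightarrow> (\<forall>n<m. fps_nth f n = 0)"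
proof
  assume "fps_X ^ m dvd f"
  then show "\<forall>n<m. fps_nth f n = 0" by (auto simp: fps_X_power_mult_nth elim!: dvdE)
next
  assume *: "\<forall>n<m. fps_nth f n = 0"
  have "f = fps_X ^ m * fps_shift m f"
    by (rule fps_ext) (use * in \<open>auto simp: fps_X_power_mult_nth\<close>)
  then show "fps_X ^ m dvd f" by (metis dvd_triv_left)
qed

definition partition_gf :: "nat multiset set \<Rightarrow> int fps" where
  "partition_gf A = Abs_fps (\<lambda>n. int (card (A \<inter> partitions n)))"

lemma partition_gf_nth [simp]: "fps_nth (partition_gf A) n = int (card (A \<inter> partitions n))"
  by (simp add: partition_gf_def)

lemma partition_gf_empty [simp]: "partition_gf {} = 0"
  by (rule fps_ext) simp

lemma partition_gf_Un:
  "A \<inter> B = {} \<Longrightarrow> partition_gf (A \<union> B) = partition_gf A + partition_gf B"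
proof (rule fps_ext)
  fix n assume "A \<inter> B = {}"
  then have "card ((A \<union> B) \<inter> partitions n) = card (A \<inter> partitions n) + card (B \<inter> partitions n)"
    by (subst card_Un_disjoint[symmetric]) (auto simp: finite_partitions Int_Un_distrib2)
  then show "fps_nth (partition_gf (A \<union> B)) n = fps_nth (partition_gf A + partition_gf B) n"
    by simp
qed

text \<open>If every multiset in a class is in exactly one way the union of a member of \<open>A\<close> and a member of \<open>B\<close>,
  counting by the weight of the first member is the Cauchy product.\<close>
lemma partition_gf_mult:
  assumes inj: "inj_on (\<lambda>(M, M'). M + M') (A \<times> B)"
  shows "partition_gf ((\<lambda>(M, M'). M + M') ` (A \<times> B)) = partition_gf A * partition_gf B"
proof (rule fps_ext)
  fix n
  let ?C = "\<lambda>i. (A \<inter> partitions i) \<times> (B \<inter> partitions (n - i))"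
  have "((\<lambda>(M, M'). M + M') ` (A \<times> B)) \<inter> partitions n = (\<lambda>(M, M'). M + M') ` (\<Union>i\<le>n. ?C i)"
    by (auto simp: partitions_def image_iff)
  moreover have "inj_on (\<lambda>(M, M'). M + M') (\<Union>i\<le>n. ?C i)"
    by (rule inj_on_subset[OF inj]) auto
  ultimately have "card (((\<lambda>(M, M'). M + M') ` (A \<times> B)) \<inter> partitions n) = card (\<Union>i\<le>n. ?C i)"
    by (simp add: card_image)
  also have "\<dots> = (\<Sum>i\<le>n. card (?C i))"
    by (rule card_UN_disjoint) (auto simp: finite_partitions, auto simp: partitions_def)
  finally show "fps_nth (partition_gf ((\<lambda>(M, M'). M + M') ` (A \<times> B))) n = fps_nth (partition_gf A * partition_gf B) n"
    by (simp add: fps_mult_nth card_cartesian_product atMost_atLeast0)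
qed

lemma partition_gf_replicate:
  assumes "0 < s"
  shows "partition_gf ((\<lambda>M. M + replicate_mset j s) ` A) = fps_X ^ (s * j) * partition_gf A"
proof -
  have "partition_gf {replicate_mset j s} = fps_X ^ (s * j)"
  proof (rule fps_ext)
    fix n
    have "{replicate_mset j s} \<inter> partitions n = (if n = s * j then {replicate_mset j s} else {})"
      using assms by (auto simp: partitions_def sum_mset_replicate_mset)
    then show "fps_nth (partition_gf {replicate_mset j s}) n = fps_nth (fps_X ^ (s * j)) n"
      by (simp add: fps_X_power_nth)
  qed
  moreover have "(\<lambda>M. M + replicate_mset j s) ` A = (\<lambda>(M, M'). M + M') ` (A \<times> {replicate_mset j s})"
    by auto
  ultimately show ?thesis
    using partition_gf_mult[of A "{replicate_mset j s}"] by (simp add: inj_on_def mult.commute)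
qed

lemma partition_gf_cong_1:
  assumes "{#} \<in> A" "\<And>M p. M \<in> A \<Longrightarrow> p \<in># M \<Longrightarrow> m \<le> p"
  shows "fps_X ^ m dvd partition_gf A - 1"
  unfolding fps_X_power_dvd_iff
proof (intro allI impI)
  fix n assume n: "n < m"
  have empty: "M = {#}" if "M \<in> A" "M \<in> partitions n" for M
  proof (rule ccontr)
    assume "M \<noteq> {#}"
    then obtain p where p: "p \<in># M" by blast
    then have "p \<le> n" using that sum_mset.remove[of p M] by (simp add: partitions_def)
    with assms(2)[OF that(1) p] n show False by simp
  qed
  have "{#} \<in> partitions n \<longleftrightarrow> n = 0" by (auto simp: partitions_def)
  then have "A \<inter> partitions n = (if n = 0 then {{#}} else {})"
    using assms(1) empty by auto
  then show "fps_nth (partition_gf A - 1) n = 0" by simp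
qed

definition parts_in :: "nat set \<Rightarrow> nat multiset set" where
  "parts_in S = {M. set_mset M \<subseteq> S}"

text \<open>A partition into parts from \<open>insert s S\<close> either does not use \<open>s\<close>, or is such a partition with one
  more \<open>s\<close>.\<close>
lemma partition_gf_parts_in_insert:
  assumes "0 < s" "s \<notin> S"
  shows "partition_gf (parts_in (insert s S)) * (1 - fps_X ^ s) = partition_gf (parts_in S)"
proof -
  let ?add = "\<lambda>M. M + replicate_mset 1 s"
  have "parts_in (insert s S) = parts_in S \<union> ?add ` parts_in (insert s S)"
  proof (intro equalityI subsetI)
    fix M assume M: "M \<in> parts_in (insert s S)"
    show "M \<in> parts_in S \<union> ?add ` parts_in (insert s S)"
    proof (cases "s \<in># M")
      case True
      then have "M = ?add (M - {#s#})" by simp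
      moreover have "M - {#s#} \<in> parts_in (insert s S)"
        using M by (auto simp: parts_in_def dest: in_diffD)
      ultimately show ?thesis by blast
    qed (use M in \<open>auto simp: parts_in_def\<close>)
  qed (auto simp: parts_in_def)
  moreover have "parts_in S \<inter> ?add ` parts_in (insert s S) = {}"
    using assms by (auto simp: parts_in_def)
  ultimately have "partition_gf (parts_in (insert s S))
      = partition_gf (parts_in S) + fps_X ^ s * partition_gf (parts_in (insert s S))"
    using partition_gf_Un[of "parts_in S" "?add ` parts_in (insert s S)"]
      partition_gf_replicate[OF assms(1), of 1 "parts_in (insert s S)"] by (simp only: mult_1_right)
  then show ?thesis by (simp add: algebra_simps)
qed

text \<open>Euler's product, truncated: multiplying by \<open>1 - X^p\<close> removes the part \<open>p\<close>, and once all parts up to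
  \<open>n\<close> are gone only the empty partition has weight at most \<open>n\<close>.\<close>
lemma partition_gf_parts_in:
  assumes "0 \<notin> S"
  shows "fps_X ^ (n + 1) dvd partition_gf (parts_in S) * (\<Prod>p \<in> {1..n} \<inter> S. 1 - fps_X ^ p) - 1"
proof -
  have "partition_gf (parts_in S) * (\<Prod>p \<in> {1..n} \<inter> S. 1 - fps_X ^ p) = partition_gf (parts_in (S - {1..n}))"
  proof (induction n)
    case (Suc n)
    show ?case
    proof (cases "Suc n \<in> S")
      case True
      have "S - {1..n} = insert (Suc n) (S - {1..Suc n})" using True by auto
      moreover have "{1..Suc n} \<inter> S = insert (Suc n) ({1..n} \<inter> S)" using True by auto
      then have "partition_gf (parts_in S) * (\<Prod>p \<in> {1..Suc n} \<inter> S. 1 - fps_X ^ p)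
          = partition_gf (parts_in S) * (\<Prod>p \<in> {1..n} \<inter> S. 1 - fps_X ^ p) * (1 - fps_X ^ Suc n)"
        by (simp add: mult_ac del: power_Suc)
      moreover have "partition_gf (parts_in (insert (Suc n) (S - {1..Suc n}))) * (1 - fps_X ^ Suc n)
          = partition_gf (parts_in (S - {1..Suc n}))"
        by (rule partition_gf_parts_in_insert) auto
      ultimately show ?thesis
        using Suc by (simp only:)
    next
      case False
      then have "S - {1..Suc n} = S - {1..n}" "{1..Suc n} \<inter> S = {1..n} \<inter> S"
        by (auto simp: le_Suc_eq)
      then show ?thesis using Suc by simp
    qed
  qed simp
  moreover have "fps_X ^ (n + 1) dvd partition_gf (parts_in (S - {1..n})) - 1"
  proof (rule partition_gf_cong_1)
    fix M p assume "M \<in> parts_in (S - {1..n})" "p \<in># M"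
    then have "p \<in> S - {1..n}" by (auto simp: parts_in_def)
    then show "n + 1 \<le> p" using assms by (cases p) auto
  qed (simp add: parts_in_def)
  ultimately show ?thesis by simp
qed

section \<open>Gordon's identity\<close>
text \<open>The parameter \<open>N\<close> is a lower bound for the parts, the analogue of the argument \<open>x = q^N\<close> in Andrews's
  functions. Gordon's partitions are those with \<open>N = 0\<close>.\<close>
definition gordon :: "nat \<Rightarrow> nat \<Rightarrow> nat \<Rightarrow> nat multiset set" where
  "gordon k N i = {M. (\<forall>p \<in># M. N < p) \<and> count M (N + 1) < i \<and> (\<forall>j>N. count M j + count M (j + 1) < k)}"

text \<open>The partitions in which the smallest admissible part \<open>N + 1\<close> occurs exactly \<open>i\<close> times: removing these
  occurrences leaves parts above \<open>N + 1\<close>, and the condition on \<open>N + 1\<close> and \<open>N + 2\<close> becomes the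
  restriction that \<open>N + 2\<close> occurs fewer than \<open>k - i\<close> times.\<close>
lemma gordon_Suc:
  assumes "i < k"
  shows "gordon k N (Suc i) = gordon k N i \<union> (\<lambda>M. M + replicate_mset i (N + 1)) ` gordon k (N + 1) (k - i)"
    (is "_ = _ \<union> ?f ` ?B")
proof (intro equalityI subsetI)
  fix M assume M: "M \<in> gordon k N (Suc i)"
  show "M \<in> gordon k N i \<union> ?f ` ?B"
  proof (cases "count M (N + 1) = i")
    case True
    define M' where "M' = filter_mset (\<lambda>p. p \<noteq> N + 1) M"
    have c: "count M' j = (if j = N + 1 then 0 else count M j)" for j
      by (simp add: M'_def)
    have "M = ?f M'"
      by (rule multiset_eqI) (use True in \<open>auto simp: c\<close>)
    moreover have "M' \<in> ?B"
    proof -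
      have "\<forall>p \<in># M'. N + 1 < p"
        using M by (force simp: gordon_def M'_def)
      moreover have "count M (N + 1) + count M (N + 1 + 1) < k"
        using M by (simp add: gordon_def)
      ultimately show ?thesis using M True by (auto simp: gordon_def c)
    qed
    ultimately show ?thesis by blast
  qed (use M in \<open>auto simp: gordon_def\<close>)
next
  fix M assume "M \<in> gordon k N i \<union> ?f ` ?B"
  then show "M \<in> gordon k N (Suc i)"
  proof
    assume "M \<in> ?f ` ?B"
    then obtain M' where M: "M = ?f M'" and M': "M' \<in> ?B" by blast
    have z: "count M' (N + 1) = 0"
      using M' by (auto simp: gordon_def count_eq_zero_iff)
    have "count M j + count M (j + 1) < k" if "j > N" for j
    proof (cases "j = N + 1")
      case True
      then show ?thesis using M' z assms by (auto simp: M gordon_def)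
    qed (use M' that in \<open>auto simp: M gordon_def\<close>)
    then show ?thesis using M' z assms by (auto simp: M gordon_def split: if_splits)
  qed (auto simp: gordon_def)
qed

lemma partition_gf_gordon_Suc:
  assumes "i < k"
  shows "partition_gf (gordon k N (Suc i))
    = partition_gf (gordon k N i) + fps_X ^ ((N + 1) * i) * partition_gf (gordon k (N + 1) (k - i))"
proof -
  have "gordon k N i \<inter> (\<lambda>M. M + replicate_mset i (N + 1)) ` gordon k (N + 1) (k - i) = {}"
    by (auto simp: gordon_def)
  moreover have "0 < N + 1" by simp
  ultimately show ?thesis
    unfolding gordon_Suc[OF assms] by (simp only: partition_gf_Un partition_gf_replicate)
qed

text \<open>Gordon's generating functions and Andrews's series satisfy the same recurrence, and the series at
  \<open>N = 0\<close> is the theta series that the triple product evaluates.\<close>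
lemma partition_gf_gordon:
  fixes i k m :: nat
  assumes "0 < i" "i \<le> k"
  defines "S \<equiv> {p. p mod (2 * k + 1) \<in> {0, i, 2 * k + 1 - i}}"
  shows "fps_X ^ m dvd qpoch fps_X 0 m * partition_gf (gordon k 0 i)
     - (\<Prod>p \<in> {1..(2 * k + 1) * m} \<inter> S. 1 - fps_X ^ p)"
proof -
  let ?X = "fps_X :: int fps"
  define d where "d = 2 * k + 1"
  have i: "0 < i" "2 * i < d" "i \<le> d" using assms by (auto simp: d_def)
  have "?X ^ m dvd (\<Sum>n<m. andrews_term ?X k 0 i n) - qpoch ?X 0 m * partition_gf (gordon k 0 i)"
  proof (rule andrews_recurrence_solution)
    show "partition_gf (gordon k N 0) = 0" for N
      by (simp add: gordon_def)
    show "?X ^ m dvd partition_gf (gordon k m j) - 1" if "0 < j" "j \<le> k" for j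
      by (rule partition_gf_cong_1) (use that in \<open>auto simp: gordon_def\<close>)
  qed (use assms partition_gf_gordon_Suc in auto)
  note 1 = dvd_diff_sym[OF this]
  have "?X ^ m dvd qpoch (?X ^ d) 0 m *
      ((\<Prod>j<m. 1 - ?X ^ (d - i) * (?X ^ d) ^ j) * (\<Prod>j<m. 1 - ?X ^ i * (?X ^ d) ^ j))
      - (\<Sum>l<m. (- 1) ^ l * (?X ^ (d * triangular l - i * l) - ?X ^ (d * triangular l + Suc l * i)))"
    using truncated_jacobi_triple_product[of ?X "?X ^ (d - i)" "?X ^ i" m] i
    unfolding theta_term_power[OF i(3)] by (simp add: dvd_power flip: power_add)
  also have "(\<Sum>l<m. (- 1) ^ l * (?X ^ (d * triangular l - i * l) - ?X ^ (d * triangular l + Suc l * i)))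
      = (\<Sum>n<m. andrews_term ?X k 0 i n)"
    by (simp add: andrews_term_def d_def)
  finally have 2: "?X ^ m dvd (\<Prod>p \<in> {1..d * m} \<inter> {p. p mod d \<in> {0, i, d - i}}. 1 - ?X ^ p)
      - (\<Sum>n<m. andrews_term ?X k 0 i n)"
    unfolding triple_product_residue_classes[OF i(1,2)] .
  show ?thesis
    using dvd_diff_trans[OF 1 dvd_diff_sym[OF 2]] unfolding d_def S_def .
qed

text \<open>Write \<open>P_S\<close> and \<open>P_T\<close> for the products of \<open>1 - X^p\<close> over the excluded residue classes and over their
  complement. The preceding lemma says \<open>P_S P_T g = P_S\<close> for the generating function \<open>g\<close> of Gordon's
  partitions. The generating functions \<open>s\<close> and \<open>t\<close> of the partitions into parts from either set are inverses of
  \<open>P_S\<close> and \<open>P_T\<close>, so multiplying by \<open>s t\<close> leaves \<open>g = t\<close>.\<close>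
theorem gordon_identity:
  assumes "0 < i" "i \<le> k"
  shows "partition_gf (gordon k 0 i)
    = partition_gf (parts_in {p. p mod (2 * k + 1) \<notin> {0, i, 2 * k + 1 - i}})"
proof (rule fps_ext)
  fix n :: nat
  let ?X = "fps_X :: int fps"
  define S where "S = {p. p mod (2 * k + 1) \<in> {0, i, 2 * k + 1 - i}}"
  define T where "T = - S"
  define m where "m = n + 1"
  define L where "L = (2 * k + 1) * m"
  define g where "g = partition_gf (gordon k 0 i)"
  define t where "t = partition_gf (parts_in T)"
  define s where "s = partition_gf (parts_in (S - {0}))"
  define PS where "PS = (\<Prod>p \<in> {1..L} \<inter> S. 1 - ?X ^ p)"
  define PT where "PT = (\<Prod>p \<in> {1..L} \<inter> T. 1 - ?X ^ p)"
  have mL: "m \<le> L" by (simp add: L_def)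
  then have XL: "?X ^ m dvd ?X ^ (L + 1)" by (intro le_imp_power_dvd) simp
  have t: "?X ^ m dvd t * PT - 1"
    unfolding t_def PT_def
    by (rule dvd_trans[OF XL partition_gf_parts_in]) (simp add: T_def S_def)
  have "{1..L} \<inter> S = {1..L} \<inter> (S - {0})" by auto
  then have s: "?X ^ m dvd s * PS - 1"
    using dvd_trans[OF XL partition_gf_parts_in[of "S - {0}" L]] unfolding s_def PS_def by simp
  have "qpoch ?X 0 L = (\<Prod>p \<in> {1..L}. 1 - ?X ^ p)"
    unfolding qpoch_def by (rule prod.reindex_bij_witness[of _ "\<lambda>p. p - 1" Suc]) auto
  also have "{1..L} = ({1..L} \<inter> S) \<union> ({1..L} \<inter> T)" by (auto simp: T_def)
  also have "(\<Prod>p \<in> \<dots>. 1 - ?X ^ p) = PS * PT"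
    unfolding PS_def PT_def by (rule prod.union_disjoint) (auto simp: T_def)
  finally have all: "qpoch ?X 0 L = PS * PT" .
  have "?X ^ (m + 1) dvd qpoch ?X 0 L - qpoch ?X 0 m"
    by (rule qpoch_cong_qpoch) (use mL in auto)
  then have "?X ^ m dvd PS * PT - qpoch ?X 0 m"
    unfolding all by (rule dvd_trans[rotated]) (simp add: le_imp_power_dvd)
  then have "?X ^ m dvd PS * PT * g - qpoch ?X 0 m * g"
    by (rule dvd_diff_mult) simp
  moreover have "?X ^ m dvd qpoch ?X 0 m * g - PS"
    unfolding g_def PS_def S_def L_def using assms by (rule partition_gf_gordon)
  ultimately have "?X ^ m dvd PS * PT * g - PS"
    by (rule dvd_diff_trans)
  from dvd_diff_mult[OF _ this, of "s * t" "s * t"]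
  have 1: "?X ^ m dvd (s * PS) * (t * PT) * g - (s * PS) * t"
    by (simp add: mult_ac)
  have 2: "?X ^ m dvd (s * PS) * (t * PT) * g - 1 * 1 * g"
    by (intro dvd_diff_mult s t) simp
  have 3: "?X ^ m dvd (s * PS) * t - 1 * t"
    by (intro dvd_diff_mult s) simp
  have "?X ^ m dvd g - t"
    using dvd_diff_trans[OF dvd_diff_trans[OF dvd_diff_sym[OF 2] 1] 3] by simp
  then have "fps_nth (g - t) n = 0" unfolding fps_X_power_dvd_iff by (simp add: m_def)
  moreover have "T = {p. p mod (2 * k + 1) \<notin> {0, i, 2 * k + 1 - i}}" by (auto simp: T_def S_def)
  ultimately show "fps_nth (partition_gf (gordon k 0 i)) n
      = fps_nth (partition_gf (parts_in {p. p mod (2 * k + 1) \<notin> {0, i, 2 * k + 1 - i}})) n"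
    unfolding g_def t_def by simp
qed

section \<open>Restricting the even parts\<close>
text \<open>Conditions that concern only the even parts of a partition are conditions on this multiset.\<close>
definition even_halves :: "nat multiset \<Rightarrow> nat multiset" where
  "even_halves M = {#p div 2. p \<in># filter_mset even M#}"

lemma even_halves_odd: "M \<in> parts_in {p. odd p} \<Longrightarrow> even_halves M = {#}"
  by (induction M) (auto simp: even_halves_def parts_in_def)

lemma even_halves_double: "even_halves (image_mset ((*) 2) M) = M"
  by (simp add: even_halves_def filter_mset_image_mset multiset.map_comp comp_def)

lemma even_halves_add: "even_halves (M + M') = even_halves M + even_halves M'"
  by (simp add: even_halves_def)

lemma double_even_halves: "image_mset ((*) 2) (even_halves M) = filter_mset even M"
  by (induction M) (auto simp: even_halves_def)

lemma count_even_halves: "count (even_halves M) j = count M (2 * j)"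
proof -
  have *: "count (image_mset ((*) 2) A) (2 * j) = count A j" for A :: "nat multiset"
    by (induction A) auto
  have "count M (2 * j) = count (image_mset ((*) 2) (even_halves M)) (2 * j)"
    by (simp add: double_even_halves)
  also have "\<dots> = count (even_halves M) j"
    by (rule *)
  finally show ?thesis by simp
qed

lemma in_even_halves_iff: "j \<in># even_halves M \<longleftrightarrow> 2 * j \<in># M"
  by (metis count_even_halves count_greater_zero_iff)

text \<open>A partition is determined by its odd parts, which are arbitrary, and by the halves of its even parts.\<close>
lemma partition_gf_even_halves:
  "partition_gf {M. even_halves M \<in> A} =
     partition_gf (parts_in {p. odd p}) * partition_gf (image_mset ((*) 2) ` A)"
proof -
  let ?O = "parts_in {p. odd p}" and ?D = "image_mset ((*) 2) ` A"
  have O: "even_halves (M + image_mset ((*) 2) M') = M'" if "M \<in> ?O" for M M'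
    using that by (simp add: even_halves_add even_halves_odd even_halves_double)
  have "inj_on (\<lambda>(M, M'). M + M') (?O \<times> ?D)"
  proof (rule inj_onI, clarify)
    fix M1 M2 N1 N2
    assume M: "M1 \<in> ?O" "M2 \<in> ?O"
      and eq: "M1 + image_mset ((*) 2) N1 = M2 + image_mset ((*) 2) N2"
    have "N1 = N2" using O[OF M(1), of N1] O[OF M(2), of N2] eq by simp
    then show "M1 = M2 \<and> image_mset ((*) 2) N1 = image_mset ((*) 2) N2" using eq by simp
  qed
  moreover have "{M. even_halves M \<in> A} = (\<lambda>(M, M'). M + M') ` (?O \<times> ?D)"
  proof (intro equalityI subsetI)
    fix M assume M: "M \<in> {M. even_halves M \<in> A}"
    have "M = filter_mset odd M + image_mset ((*) 2) (even_halves M)"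
      by (simp add: double_even_halves add.commute flip: multiset_partition)
    moreover have "filter_mset odd M \<in> ?O" by (auto simp: parts_in_def)
    ultimately show "M \<in> (\<lambda>(M, M'). M + M') ` (?O \<times> ?D)" using M by force
  qed (use O in auto)
  ultimately show ?thesis by (simp add: partition_gf_mult)
qed

lemma partition_gf_double_nth:
  "fps_nth (partition_gf (image_mset ((*) 2) ` A)) n
    = (if even n then fps_nth (partition_gf A) (n div 2) else 0)"
proof -
  have *: "image_mset ((*) 2) M \<in> partitions n \<longleftrightarrow> even n \<and> M \<in> partitions (n div 2)" for M
    by (auto simp: partitions_def simp flip: sum_mset_distrib_left)
  have "image_mset ((*) 2) ` A \<inter> partitions n
      = (if even n then image_mset ((*) 2) ` (A \<inter> partitions (n div 2)) else {})"
    by (auto simp: *)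
  moreover have "inj_on (image_mset ((*) 2)) (A \<inter> partitions (n div 2))"
    by (metis even_halves_double inj_onI)
  ultimately show ?thesis by (simp add: card_image)
qed

text \<open>This transports an identity for arbitrary partitions to the even parts: in the product with the
  odd partitions the other factor is the generating function of \<open>A\<close> at \<open>X^2\<close>.\<close>
lemma partition_gf_even_halves_cong:
  assumes "partition_gf A = partition_gf B"
  shows "partition_gf {M. even_halves M \<in> A} = partition_gf {M. even_halves M \<in> B}"
proof -
  have "partition_gf (image_mset ((*) 2) ` A) = partition_gf (image_mset ((*) 2) ` B)"
    by (rule fps_ext) (simp only: partition_gf_double_nth assms)
  then show ?thesis by (simp only: partition_gf_even_halves)
qed

lemma cong_mod_18_iff:
  "(\<not> [int p = 0] (mod 18) \<and> \<not> [int p = 8] (mod 18) \<and> \<not> [int p = - 8] (mod 18))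
    \<longleftrightarrow> (even p \<longrightarrow> p div 2 mod 9 \<notin> {0, 4, 5})"
proof -
  have "int m = 0 \<or> int m = 8 \<or> int m = 10 \<longleftrightarrow> m = 0 \<or> m = 8 \<or> m = 10" for m by auto
  from this[of "p mod 18"]
  have 1: "([int p = 0] (mod 18) \<or> [int p = 8] (mod 18) \<or> [int p = - 8] (mod 18))
      \<longleftrightarrow> p mod 18 = 0 \<or> p mod 18 = 8 \<or> p mod 18 = 10"
    by (simp add: cong_def zmod_int)
  have 2: "2 * a + b = 2 * c \<longleftrightarrow> b = 0 \<and> a = c" if "b < 2" for a b c :: nat
    using that by arith
  have "p mod (2 * 9) = 2 * (p div 2 mod 9) + p mod 2" by (rule mod_mult2_eq)
  then have "p mod 18 = 2 * (p div 2 mod 9) + p mod 2" by simp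
  then have 3: "p mod 18 = 2 * c \<longleftrightarrow> even p \<and> p div 2 mod 9 = c" for c
    using 2[of "p mod 2" "p div 2 mod 9" c] by (simp add: even_iff_mod_2_eq_zero)
  show ?thesis using 1 3[of 0] 3[of 4] 3[of 5] by auto
qed

theorem corollary1p5:
  fixes n :: nat
  shows "card {M \<in> partitions n. count M 2 \<le> 3 \<and>
                (\<forall>j\<ge>1. count M (2 * j) + count M (2 * j + 2) \<le> 3)}
       = card {M \<in> partitions n. \<forall>p \<in># M.
                \<not> [int p = 0] (mod 18) \<and> \<not> [int p = 8] (mod 18) \<and> \<not> [int p = - 8] (mod 18)}"
proof -
  define T :: "nat set" where "T = {p. p mod 9 \<notin> {0, 4, 5}}"
  have gf: "partition_gf {M. even_halves M \<in> gordon 4 0 4} = partition_gf {M. even_halves M \<in> parts_in T}"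
    using gordon_identity[of 4 4] unfolding T_def by (intro partition_gf_even_halves_cong) simp
  have L: "even_halves M \<in> gordon 4 0 4 \<longleftrightarrow>
      count M 2 \<le> 3 \<and> (\<forall>j\<ge>1. count M (2 * j) + count M (2 * j + 2) \<le> 3)" if "M \<in> partitions n" for M
  proof -
    have "\<forall>j \<in># even_halves M. 0 < j"
      using that by (force simp: in_even_halves_iff partitions_def)
    then have "even_halves M \<in> gordon 4 0 4 \<longleftrightarrow>
        count M 2 < 4 \<and> (\<forall>j>0. count M (2 * j) + count M (2 * j + 2) < 4)"
      by (simp add: gordon_def count_even_halves)
    moreover have "m < 4 \<longleftrightarrow> m \<le> 3" "0 < m \<longleftrightarrow> 1 \<le> m" for m :: nat by auto
    ultimately show ?thesis by (simp only:)
  qed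
  have R: "even_halves M \<in> parts_in T \<longleftrightarrow>
      (\<forall>p \<in># M. \<not> [int p = 0] (mod 18) \<and> \<not> [int p = 8] (mod 18) \<and> \<not> [int p = - 8] (mod 18))" for M
  proof -
    have "even_halves M \<in> parts_in T \<longleftrightarrow> (\<forall>j. 2 * j \<in># M \<longrightarrow> j \<in> T)"
      unfolding parts_in_def mem_Collect_eq subset_iff in_even_halves_iff ..
    also have "\<dots> \<longleftrightarrow> (\<forall>p \<in># M. even p \<longrightarrow> p div 2 \<in> T)"
      by (auto elim!: evenE)
    finally show ?thesis unfolding cong_mod_18_iff T_def by simp
  qed
  have "{M \<in> partitions n. count M 2 \<le> 3 \<and> (\<forall>j\<ge>1. count M (2 * j) + count M (2 * j + 2) \<le> 3)}
      = {M. even_halves M \<in> gordon 4 0 4} \<inter> partitions n"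
    using L by blast
  moreover have "{M \<in> partitions n. \<forall>p \<in># M.
        \<not> [int p = 0] (mod 18) \<and> \<not> [int p = 8] (mod 18) \<and> \<not> [int p = - 8] (mod 18)}
      = {M. even_halves M \<in> parts_in T} \<inter> partitions n"
    unfolding R by blast
  ultimately show ?thesis
    using gf[THEN arg_cong, of "\<lambda>f. fps_nth f n"] by simp
qed

end
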